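(* Let $\varphi(n)$ be Euler's phi function, $\varphi(n)=n\prod_{p\mid n}\left(1-\frac1p\right)$. Then $\{\varphi(n)\}_{n\ge 1}$ is not a strong Benford sequence.
   Context: Strong Benford: Every positive real $a$ is written $a=10^{M}\sum_{j\ge 0} d_j 10^{-j}$ with $M\in\mathbb{Z}$, $1\le d_0\le 9$, $0\le d_j\le 9$ for $j\ge 1$ (usual convention: the digits are not eventually all $9$); the $d_j$ are the digits of $a$. A sequence $\{a_k\}_{k\ge1}$ of positive reals is strong Benford if for every positive integer $K$ and every digit string $S=d_0d_1\cdots d_{K-1}$ with $d_0\ne 0$, $$\lim_{N\to\infty}\frac{\#\{k\le N: \text{the first } K \text{ digits of } a_k \text{ are } d_0,\dots,d_{K-1}\}}{N}=\log_{10}(r+10^{-K+1})-\log_{10} r,\qquad r=\sum_{j=0}^{K-1}d_j10^{-j}.$$ *)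

theory Defs
  imports Complex_Main "HOL-Number_Theory.Totient"
begin

(* a = 10^M * (d 0 + d 1 / 10 + d 2 / 100 + ...), normalised by d 0 \<noteq> 0 and by excluding
   tails of nines, so M and d are determined by a; a has such an expansion iff a > 0. *)
definition decimal_expansion :: "real \<Rightarrow> int \<Rightarrow> (nat \<Rightarrow> nat) \<Rightarrow> bool" where
  "decimal_expansion a M d \<longleftrightarrow>
     1 \<le> d 0 \<and> (\<forall>j. d j \<le> 9) \<and> \<not> (\<forall>\<^sub>F j in sequentially. d j = 9) \<and>
     summable (\<lambda>j. real (d j) / 10 ^ j) \<and>
     a = 10 powi M * (\<Sum>j. real (d j) / 10 ^ j)"

definition starts_with_digits :: "real \<Rightarrow> nat list \<Rightarrow> bool" where
  "starts_with_digits a S \<longleftrightarrow>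
     (\<exists>M d. decimal_expansion a M d \<and> (\<forall>j<length S. d j = S ! j))"

definition digit_string :: "nat list \<Rightarrow> bool" where
  "digit_string S \<longleftrightarrow> S \<noteq> [] \<and> set S \<subseteq> {0..9} \<and> S ! 0 \<noteq> 0"

definition significand :: "nat list \<Rightarrow> real" where
  "significand S = (\<Sum>j<length S. real (S ! j) / 10 ^ j)"

(* Meant for sequences with a k > 0 for all k \<ge> 1; the value a 0 is irrelevant. *)
definition strong_benford :: "(nat \<Rightarrow> real) \<Rightarrow> bool" where
  "strong_benford a \<longleftrightarrow>
     (\<forall>S. digit_string S \<longrightarrow>
       (\<lambda>N. real (card {k \<in> {1..N}. starts_with_digits (a k) S}) / real N)
         \<longlonglongrightarrow> log 10 (significand S + 10 powi (1 - int (length S))) - log 10 (significand S))"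

end

theory Submission
  imports Defs "HOL-Analysis.Infinite_Products" "HOL-Real_Asymp.Real_Asymp"
begin

text \<open>
  If the sequence were strong Benford, then for \<open>M = 10 ^ k\<close> about \<open>2 * M * log 10 (10 / 3)\<close> of the
  \<open>n\<close> in the short window \<open>{98 * M<..100 * M}\<close> would have a totient with leading digit at least 3.
  In this window \<open>n\<close> is nearly constant, so it suffices that \<open>totient n / n\<close> is not much below
  \<open>3 / 10\<close>. Now \<open>totient n / n\<close> is at least \<open>1 - e n\<close> for odd \<open>n\<close> and half of that for even \<open>n\<close>,
  where \<open>e n\<close> is the sum of the \<open>1 / d\<close> over the odd divisors \<open>d > 1\<close> of \<open>n\<close>. Since \<open>e\<close> has mean
  \<open>1 / 3\<^sup>2 + 1 / 5\<^sup>2 + 1 / 7\<^sup>2 + \<dots> < 0.2341\<close>, Markov's inequality makes the proportion of such \<open>n\<close> at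
  least \<open>0.529\<close>, whereas \<open>log 10 (10 / 3) < 11 / 21 < 0.524\<close>.
\<close>

section \<open>Decimal digits of natural numbers\<close>

lemma sum_decimal_digits:
  fixes x :: nat
  shows "(\<Sum>j\<le>L. (x div 10 ^ (L - j)) mod 10 * 10 ^ (L - j)) = x mod 10 ^ Suc L"
proof (induction L arbitrary: x)
  case (Suc L)
  have "(\<Sum>j\<le>Suc L. (x div 10 ^ (Suc L - j)) mod 10 * 10 ^ (Suc L - j))
      = (\<Sum>j\<le>L. (x div 10 ^ (Suc L - j)) mod 10 * 10 ^ (Suc L - j)) + x mod 10"
    by simp
  also have "(\<Sum>j\<le>L. (x div 10 ^ (Suc L - j)) mod 10 * 10 ^ (Suc L - j))
      = (\<Sum>j\<le>L. 10 * ((x div 10 div 10 ^ (L - j)) mod 10 * 10 ^ (L - j)))"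
    by (intro sum.cong) (auto simp: Suc_diff_le div_mult2_eq)
  also have "\<dots> = 10 * ((x div 10) mod 10 ^ Suc L)"
    by (simp only: Suc.IH flip: sum_distrib_left)
  also have "\<dots> + x mod 10 = x mod 10 ^ Suc (Suc L)"
    using mod_mult2_eq[of x 10 "10 ^ Suc L"] by simp
  finally show ?case .
qed simp

lemma starts_with_leading_digit:
  fixes x :: nat
  assumes "10 ^ L \<le> x" "x < 10 ^ Suc L"
  shows "starts_with_digits (real x) [x div 10 ^ L]"
proof -
  \<comment> \<open>Most significant digit first, padded with zeros: the series becomes a finite sum
    and a tail of nines is impossible.\<close>
  define d where "d = (\<lambda>j. if j \<le> L then (x div 10 ^ (L - j)) mod 10 else 0)"
  have d0: "d 0 = x div 10 ^ L"
    using assms by (simp add: d_def less_mult_imp_div_less)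
  have "(\<lambda>j. real (d j) / 10 ^ j) sums (\<Sum>j\<le>L. real (d j) / 10 ^ j)"
    by (rule sums_finite) (auto simp: d_def)
  also have "(\<Sum>j\<le>L. real (d j) / 10 ^ j)
      = (\<Sum>j\<le>L. real ((x div 10 ^ (L - j)) mod 10 * 10 ^ (L - j))) / 10 ^ L"
    unfolding sum_divide_distrib
    by (intro sum.cong) (auto simp: d_def field_simps simp flip: power_add)
  also have "\<dots> = real x / 10 ^ L"
    using assms by (simp only: sum_decimal_digits flip: of_nat_sum) simp
  finally have sums: "(\<lambda>j. real (d j) / 10 ^ j) sums (real x / 10 ^ L)" .
  have "decimal_expansion (real x) (int L) d"
    unfolding decimal_expansion_def
  proof (intro conjI allI)
    show "1 \<le> d 0"
      unfolding d0 using assms div_le_mono[of "10 ^ L" x "10 ^ L"] by simp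
    show "d j \<le> 9" for j
      using less_Suc_eq_le[of "(x div 10 ^ (L - j)) mod 10" 9] by (simp add: d_def)
    show "\<not> (\<forall>\<^sub>F j in sequentially. d j = 9)"
    proof
      assume "\<forall>\<^sub>F j in sequentially. d j = 9"
      then obtain N where "\<And>j. j \<ge> N \<Longrightarrow> d j = 9"
        by (auto simp: eventually_sequentially)
      from this[of "N + Suc L"] show False by (simp add: d_def)
    qed
    show "summable (\<lambda>j. real (d j) / 10 ^ j)"
      using sums by (rule sums_summable)
    show "real x = 10 powi int L * (\<Sum>j. real (d j) / 10 ^ j)"
      using sums_unique[OF sums, symmetric] by simp
  qed
  with d0 show ?thesis
    unfolding starts_with_digits_def by (intro exI[of _ "int L"] exI[of _ d]) auto
qed

section \<open>Bounding the totient by a divisor sum\<close>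

text \<open>All odd divisors are taken, not only primes, so that averaging over \<open>n\<close>
  needs nothing about primes. The cutoff \<open>J\<close> is independent of \<open>n\<close>, which
  lets the sums be swapped.\<close>

definition odd_divisor_sum :: "nat \<Rightarrow> nat \<Rightarrow> real" where
  "odd_divisor_sum J n = (\<Sum>j\<in>{1..J}. if 2 * j + 1 dvd n then 1 / real (2 * j + 1) else 0)"

lemma odd_divisor_sum_nonneg: "odd_divisor_sum J n \<ge> 0"
  unfolding odd_divisor_sum_def by (intro sum_nonneg) auto

lemma sum_odd_prime_factors_le:
  assumes "n > 0" "n \<le> 2 * J + 1"
  shows "(\<Sum>p\<in>prime_factors n - {2}. 1 / real p) \<le> odd_divisor_sum J n"
proof -
  let ?I = "{j\<in>{1..J}. 2 * j + 1 dvd n}"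
  have "odd_divisor_sum J n = (\<Sum>j\<in>?I. 1 / real (2 * j + 1))"
    unfolding odd_divisor_sum_def by (intro sum.mono_neutral_cong_right) auto
  also have "\<dots> = (\<Sum>d\<in>(\<lambda>j. 2 * j + 1) ` ?I. 1 / real d)"
    by (subst sum.reindex) (auto simp: inj_on_def)
  also have "\<dots> \<ge> (\<Sum>p\<in>prime_factors n - {2}. 1 / real p)"
  proof (rule sum_mono2)
    show "prime_factors n - {2} \<subseteq> (\<lambda>j. 2 * j + 1) ` ?I"
    proof
      fix p assume "p \<in> prime_factors n - {2}"
      then have p: "prime p" "p dvd n" "p \<noteq> 2" by (auto simp: in_prime_factors_iff)
      then have "p > 2" using prime_ge_2_nat[of p] by simp
      then have "odd p" using prime_odd_nat p(1) by blast
      then obtain j where "p = 2 * j + 1" by (auto elim: oddE)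
      moreover have "p \<le> n" using p assms by (auto dest: dvd_imp_le)
      ultimately show "p \<in> (\<lambda>j. 2 * j + 1) ` ?I" using assms p \<open>p > 2\<close> by auto
    qed
  qed auto
  finally show ?thesis .
qed

text \<open>In the product formula the factor at 2 is kept exactly; the Weierstrass inequality
  bounds the product over the odd primes below by 1 minus the sum of their reciprocals.\<close>

lemma totient_lower_bound:
  assumes "n > 0" "n \<le> 2 * J + 1"
  shows "real (totient n) \<ge> real n * ((if even n then 1 / 2 else 1) * (1 - odd_divisor_sum J n))"
proof -
  let ?Q = "prime_factors n - {2}"
  have "1 - odd_divisor_sum J n \<le> 1 - (\<Sum>p\<in>?Q. 1 / real p)"
    using sum_odd_prime_factors_le[OF assms] by simp
  also have "\<dots> \<le> (\<Prod>p\<in>?Q. 1 - 1 / real p)"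
    by (rule Weierstrass_prod_ineq) (auto simp: in_prime_factors_iff dest: prime_gt_0_nat)
  finally have Q: "1 - odd_divisor_sum J n \<le> (\<Prod>p\<in>?Q. 1 - 1 / real p)" .
  have "(\<Prod>p\<in>prime_factors n. 1 - 1 / real p)
      = (if even n then 1 / 2 else 1) * (\<Prod>p\<in>?Q. 1 - 1 / real p)"
  proof (cases "even n")
    case True
    with assms have "2 \<in> prime_factors n" by (simp add: in_prime_factors_iff)
    then show ?thesis
      using True by (subst prod.remove[of _ 2]) auto
  next
    case False
    then have "?Q = prime_factors n" by (auto simp: in_prime_factors_iff)
    with False show ?thesis by simp
  qed
  with Q show ?thesis
    unfolding totient_formula2 by (intro mult_left_mono) auto
qed

section \<open>Averaging over a window, and Markov's inequality\<close>

lemma card_multiples_le: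
  fixes A B d :: nat
  assumes "A \<le> B" "d > 0"
  shows "real (card {n\<in>{A<..B}. d dvd n}) \<le> (real B - real A) / real d + 1"
proof -
  have "{n\<in>{A<..B}. d dvd n} \<subseteq> (\<lambda>k. d * k) ` {A div d<..B div d}"
  proof
    fix n assume n: "n \<in> {n\<in>{A<..B}. d dvd n}"
    then obtain k where k: "n = d * k" by (auto elim: dvdE)
    with n assms have "A div d < k" "k \<le> B div d"
      by (auto simp: div_less_iff_less_mult less_eq_div_iff_mult_less_eq mult.commute)
    with k show "n \<in> (\<lambda>k. d * k) ` {A div d<..B div d}" by auto
  qed
  then have "card {n\<in>{A<..B}. d dvd n} \<le> card ((\<lambda>k. d * k) ` {A div d<..B div d})"
    by (intro card_mono) auto
  also have "\<dots> \<le> B div d - A div d"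
    using card_image_le[of "{A div d<..B div d}" "\<lambda>k. d * k"] by simp
  finally have "real (card {n\<in>{A<..B}. d dvd n}) \<le> real (B div d) - real (A div d)"
    using div_le_mono[OF assms(1), of d] by linarith
  moreover have "real (B div d) \<le> real B / real d"
    by (rule of_nat_div_le_of_nat)
  moreover have "real (A div d) \<ge> real A / real d - 1"
    using floor_divide_of_nat_eq[of A d, where 'a = real] by linarith
  ultimately show ?thesis unfolding diff_divide_distrib by linarith
qed

text \<open>Swapping the sums, each \<open>2 * j + 1\<close> contributes its reciprocal times the
  number of its multiples; the second sum collects the rounding errors.\<close>

lemma sum_odd_divisor_sum_le:
  fixes A B :: nat
  assumes "A \<le> B"
  shows "(\<Sum>n\<in>{A<..B}. odd_divisor_sum J n)
    \<le> (real B - real A) * (\<Sum>j\<in>{1..J}. 1 / real (2 * j + 1) ^ 2) + (\<Sum>j\<in>{1..J}. 1 / real (2 * j + 1))"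
proof -
  have "(\<Sum>n\<in>{A<..B}. odd_divisor_sum J n)
      = (\<Sum>j\<in>{1..J}. real (card {n\<in>{A<..B}. 2 * j + 1 dvd n}) * (1 / real (2 * j + 1)))"
    unfolding odd_divisor_sum_def
    by (subst sum.swap) (simp add: sum.If_cases Int_def)
  also have "\<dots> \<le> (\<Sum>j\<in>{1..J}. ((real B - real A) / real (2 * j + 1) + 1) * (1 / real (2 * j + 1)))"
    by (intro sum_mono mult_right_mono card_multiples_le assms) auto
  also have "\<dots> = (real B - real A) * (\<Sum>j\<in>{1..J}. 1 / real (2 * j + 1) ^ 2) + (\<Sum>j\<in>{1..J}. 1 / real (2 * j + 1))"
    unfolding sum_distrib_left sum.distrib[symmetric]
    by (intro sum.cong) (simp_all only: add_divide_distrib power2_eq_square divide_divide_eq_left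
        times_divide_eq_right mult_1_right)
  finally show ?thesis .
qed

text \<open>The terms \<open>j = 1, 2, 3\<close> are exact and 1/16 bounds the tail. Telescoping
  from \<open>j = 1\<close> would give 1/4, too large for the final contradiction.\<close>

lemma sum_inverse_odd_squares_le:
  "(\<Sum>j\<in>{1..J}. 1 / real (2 * j + 1) ^ 2) \<le> 1/9 + 1/25 + 1/49 + 1/16"
proof -
  \<comment> \<open>telescoping with \<open>1 / (2 * j + 1)\<^sup>2 \<le> (1 / j - 1 / (j + 1)) / 4\<close>\<close>
  have step: "(\<Sum>j\<in>{1..m + 3}. 1 / real (2 * j + 1) ^ 2)
      \<le> 1/9 + 1/25 + 1/49 + 1/16 - 1 / (4 * (real m + 4))" for m
  proof (induction m)
    case 0
    show ?case by (simp add: numeral_3_eq_3)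
  next
    case (Suc m)
    have "1 / real (2 * (Suc m + 3) + 1) ^ 2 \<le> 1 / (4 * ((real m + 4) * (real m + 5)))"
      by (intro frac_le) (auto simp: power2_eq_square algebra_simps intro!: add_pos_nonneg)
    also have "\<dots> = 1 / (4 * (real m + 4)) - 1 / (4 * (real (Suc m) + 4))"
      by (simp add: divide_simps) (simp add: algebra_simps)
    finally show ?case
      using Suc unfolding add_Suc by (subst sum.nat_ivl_Suc') (simp, linarith)
  qed
  \<comment> \<open>Enlarging \<open>J\<close> by 3 also covers \<open>J < 3\<close>.\<close>
  have "(\<Sum>j\<in>{1..J}. 1 / real (2 * j + 1) ^ 2) \<le> (\<Sum>j\<in>{1..J + 3}. 1 / real (2 * j + 1) ^ 2)"
    by (intro sum_mono2) auto
  also have "\<dots> \<le> 1/9 + 1/25 + 1/49 + 1/16"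
    by (rule order.trans[OF step]) simp
  finally show ?thesis .
qed

text \<open>The true growth is logarithmic, but any bound of order o(\<open>J\<close>) vanishes
  after division by the window length; the square root allows a short induction.\<close>

lemma sum_inverse_odd_le_sqrt: "(\<Sum>j\<in>{1..J}. 1 / real (2 * j + 1)) \<le> sqrt (real J)"
proof (induction J)
  case (Suc J)
  have sqrt_le: "sqrt (real J) \<le> real J + 1" "sqrt (real J + 1) \<le> real J + 1"
    by (auto intro!: real_le_lsqrt simp: power2_eq_square algebra_simps)
  have "1 / real (2 * Suc J + 1) \<le> 1 / (sqrt (real J + 1) + sqrt (real J))"
    using sqrt_le by (intro divide_left_mono) (auto intro!: mult_pos_pos add_pos_nonneg)
  also have "\<dots> = sqrt (real J + 1) - sqrt (real J)"
  proof -
    have "sqrt (real J + 1) + sqrt (real J) > 0" by (intro add_pos_nonneg) auto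
    moreover have "(sqrt (real J + 1) - sqrt (real J)) * (sqrt (real J + 1) + sqrt (real J)) = 1"
      by (simp add: algebra_simps)
    ultimately show ?thesis by (simp add: field_simps)
  qed
  finally show ?case using Suc by (simp add: add.commute)
qed simp

text \<open>
  Markov's inequality with separate weights for odd and even \<open>n\<close>: if \<open>98 * M < n\<close> and
  \<open>totient n < 30 * M\<close>, then \<open>totient n / n < 15 / 49\<close>, so the divisor sum exceeds \<open>34 / 49\<close>
  for odd \<open>n\<close> and \<open>19 / 49\<close> for even \<open>n\<close>. The weight \<open>735 / 646\<close> is \<open>49 / 19 - 49 / 34\<close>.
\<close>
lemma card_large_totient_ge:
  fixes M :: nat
  shows "real (card {n\<in>{98 * M<..100 * M}. 30 * M \<le> totient n})
    \<ge> 1.0592 * real M - 49 / 19 * sqrt (50 * real M)"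
proof -
  \<comment> \<open>Then \<open>2 * J + 1\<close> exceeds every \<open>n\<close> in the window, so
    no divisor is cut off.\<close>
  define J where "J = 50 * M"
  define s where "s = (\<Sum>j\<in>{1..J}. 1 / real (2 * j + 1) ^ 2)"
  define h where "h = (\<Sum>j\<in>{1..J}. 1 / real (2 * j + 1))"
  let ?W = "{98 * M<..100 * M}" and ?E = "{49 * M<..50 * M}"
  let ?e = "odd_divisor_sum J"
  let ?good = "{n\<in>?W. 30 * M \<le> totient n}" and ?bad = "{n\<in>?W. \<not> 30 * M \<le> totient n}"
  have markov: "1 \<le> 49 / 34 * ?e n + (if even n then 735 / 646 * ?e n else 0)" if "n \<in> ?bad" for n
  proof -
    have n: "n > 0" "n \<le> 2 * J + 1" "98 * M < n" "real (totient n) < 30 * real M"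
      using that by (auto simp: J_def)
    let ?c = "(if even n then 1 / 2 else 1) * (1 - ?e n)"
    have "real n * ?c \<le> real (totient n)"
      by (rule totient_lower_bound) (use n in auto)
    also have "\<dots> < 15 / 49 * real n" using n by linarith
    finally have "?c < 15 / 49" using n by (simp add: mult.commute)
    then show ?thesis by (auto split: if_splits)
  qed
  \<comment> \<open>Writing \<open>n = 2 * m\<close> leaves the odd divisors unchanged, so the even
    part is a full sum over a window of half the length.\<close>
  have even_sum: "(\<Sum>n\<in>?W. if even n then ?e n else 0) = (\<Sum>m\<in>?E. ?e m)"
  proof -
    have "(\<Sum>n\<in>?W. if even n then ?e n else 0) = (\<Sum>n\<in>(\<lambda>m. 2 * m) ` ?E. ?e n)"
      by (intro sum.mono_neutral_cong_right) (auto elim!: evenE)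
    also have "\<dots> = (\<Sum>m\<in>?E. ?e (2 * m))"
      by (subst sum.reindex) (auto simp: inj_on_def)
    also have "\<dots> = (\<Sum>m\<in>?E. ?e m)"
      unfolding odd_divisor_sum_def
      by (intro sum.cong refl if_cong coprime_dvd_mult_right_iff) simp
    finally show ?thesis .
  qed
  have "real (card ?bad) = (\<Sum>n\<in>?bad. 1)" by simp
  also have "\<dots> \<le> (\<Sum>n\<in>?bad. 49 / 34 * ?e n + (if even n then 735 / 646 * ?e n else 0))"
    by (intro sum_mono markov)
  also have "\<dots> \<le> (\<Sum>n\<in>?W. 49 / 34 * ?e n + (if even n then 735 / 646 * ?e n else 0))"
    by (intro sum_mono2) (auto simp: odd_divisor_sum_nonneg)
  also have "\<dots> = 49 / 34 * (\<Sum>n\<in>?W. ?e n) + 735 / 646 * (\<Sum>n\<in>?W. if even n then ?e n else 0)"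
    unfolding sum.distrib sum_distrib_left by (auto intro!: sum.cong arg_cong2[of _ _ _ _ "(+)"])
  also have "\<dots> \<le> 49 / 34 * (2 * real M * s + h) + 735 / 646 * (real M * s + h)"
    unfolding even_sum
    using sum_odd_divisor_sum_le[of "98 * M" "100 * M" J] sum_odd_divisor_sum_le[of "49 * M" "50 * M" J]
    by (intro add_mono mult_left_mono) (auto simp: s_def h_def)
  also have "\<dots> = 2597 / 646 * (real M * s) + 49 / 19 * h"
    by (simp add: field_simps)
  also have "\<dots> \<le> 2597 / 646 * (real M * (1/9 + 1/25 + 1/49 + 1/16)) + 49 / 19 * sqrt (50 * real M)"
    using sum_inverse_odd_squares_le[of J] sum_inverse_odd_le_sqrt[of J]
    by (intro add_mono mult_left_mono) (auto simp: s_def h_def J_def)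
  \<comment> \<open>The bracket is about 0.23402, which gives about 0.94079; the constant 1.0592 in
    the claim is 2 - 0.9408.\<close>
  also have "\<dots> \<le> 0.9408 * real M + 49 / 19 * sqrt (50 * real M)"
    by simp
  finally have bad: "real (card ?bad) \<le> 0.9408 * real M + 49 / 19 * sqrt (50 * real M)" .
  have "?W = ?good \<union> ?bad" by auto
  then have "card ?W = card (?good \<union> ?bad)" by (rule arg_cong)
  also have "\<dots> = card ?good + card ?bad"
    by (rule card_Un_disjoint) auto
  finally have "real (card ?good) + real (card ?bad) = 2 * real M" by simp
  with bad show ?thesis by simp
qed

text \<open>This amounts to 10^10 < 3^21 = 10460353203, that is, log 10 3 > 10/21.\<close>

lemma log_10_3_bound: "log 10 10 - log 10 3 < (11 / 21 :: real)"
proof -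
  have "log 10 (10 ^ 10 :: real) < log 10 (3 ^ 21)"
    by (subst log_less_cancel_iff) auto
  then show ?thesis by (simp only: log_nat_power) simp
qed

section \<open>Leading digits in short windows\<close>

lemma strong_benford_leading_digit:
  assumes "strong_benford a" "d \<in> {1..9}"
  shows "(\<lambda>N. real (card {k\<in>{1..N}. starts_with_digits (a k) [d]}) / real N)
    \<longlonglongrightarrow> log 10 (real (Suc d)) - log 10 (real d)"
proof -
  have "digit_string [d]" using assms(2) by (auto simp: digit_string_def)
  with assms(1) have "(\<lambda>N. real (card {k\<in>{1..N}. starts_with_digits (a k) [d]}) / real N)
      \<longlonglongrightarrow> log 10 (significand [d] + 10 powi (1 - int (length [d]))) - log 10 (significand [d])"
    unfolding strong_benford_def by blast
  then show ?thesis by (simp add: significand_def add.commute)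
qed

text \<open>The window count is a difference of two initial counts, and both ends are fixed
  multiples of \<open>10 ^ k\<close>, so the limit is \<open>100 * l - 98 * l\<close>.\<close>

lemma strong_benford_window:
  assumes "strong_benford a" "d \<in> {1..9}"
  shows "(\<lambda>k. real (card {n\<in>{98 * 10 ^ k<..100 * 10 ^ k}. starts_with_digits (a n) [d]}) / 10 ^ k)
    \<longlonglongrightarrow> 2 * (log 10 (real (Suc d)) - log 10 (real d))"
proof -
  define C where "C N = card {n\<in>{1..N}. starts_with_digits (a n) [d]}" for N
  define l where "l = log 10 (real (Suc d)) - log 10 (real d)"
  have lim: "(\<lambda>N. real (C N) / real N) \<longlonglongrightarrow> l"
    using strong_benford_leading_digit[OF assms] by (simp add: C_def l_def)
  have at: "filterlim (\<lambda>k::nat. c * 10 ^ k :: nat) at_top at_top" if "c > 0" for c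
  proof (rule filterlim_at_top_mono[OF filterlim_ident], rule always_eventually, rule allI)
    fix k :: nat
    have "k < 10 ^ k" by (rule power_gt_expt) simp
    also have "\<dots> \<le> c * 10 ^ k" using that by simp
    finally show "k \<le> c * 10 ^ k" by simp
  qed
  have "(\<lambda>k. 100 * (real (C (100 * 10 ^ k)) / real (100 * 10 ^ k))
          - 98 * (real (C (98 * 10 ^ k)) / real (98 * 10 ^ k))) \<longlonglongrightarrow> 100 * l - 98 * l"
    by (intro tendsto_diff tendsto_mult tendsto_const filterlim_compose[OF lim at]) simp_all
  moreover have "real (card {n\<in>{98 * 10 ^ k<..100 * 10 ^ k}. starts_with_digits (a n) [d]}) / 10 ^ k
      = 100 * (real (C (100 * 10 ^ k)) / real (100 * 10 ^ k))
          - 98 * (real (C (98 * 10 ^ k)) / real (98 * 10 ^ k))" for k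
  proof -
    have "{n\<in>{1..100 * 10 ^ k}. starts_with_digits (a n) [d]}
        = {n\<in>{1..98 * 10 ^ k}. starts_with_digits (a n) [d]}
          \<union> {n\<in>{98 * 10 ^ k<..100 * 10 ^ k}. starts_with_digits (a n) [d]}" by auto
    then have "C (100 * 10 ^ k)
        = C (98 * 10 ^ k) + card {n\<in>{98 * 10 ^ k<..100 * 10 ^ k}. starts_with_digits (a n) [d]}"
      unfolding C_def by (simp only:) (rule card_Un_disjoint; auto)
    then show ?thesis by (simp add: field_simps)
  qed
  ultimately show ?thesis by (simp add: l_def)
qed

lemma large_totient_leading_digit:
  assumes "n \<in> {98 * 10 ^ k<..100 * 10 ^ k}" "30 * 10 ^ k \<le> totient n"
  shows "\<exists>d\<in>{3..9}. starts_with_digits (real (totient n)) [d]"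
proof -
  let ?x = "totient n" and ?L = "Suc k"
  have "(0::nat) < 10 ^ k" by simp
  \<comment> \<open>Needed for \<open>totient n < n\<close>: the strict inequality keeps the totient
    below \<open>100 * 10 ^ k\<close> even at the right end, so it has exactly \<open>k + 2\<close>
    digits.\<close>
  with assms have "n > 1" by simp
  then have "?x < n" by (rule totient_less)
  with assms have x: "10 ^ ?L \<le> ?x" "?x < 10 ^ Suc ?L" by auto
  then have "?x div 10 ^ ?L \<le> 9" by (simp add: div_less_iff_less_mult less_Suc_eq_le[symmetric])
  moreover have "3 \<le> ?x div 10 ^ ?L"
    using assms by (simp add: less_eq_div_iff_mult_less_eq)
  ultimately show ?thesis
    using starts_with_leading_digit[OF x] by (intro bexI[of _ "?x div 10 ^ ?L"]) auto
qed

theorem corollary1p5: "\<not> strong_benford (\<lambda>n. real (totient n))"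
proof
  assume benford: "strong_benford (\<lambda>n. real (totient n))"
  define D where "D d k = {n\<in>{98 * 10 ^ k<..100 * 10 ^ k}. starts_with_digits (real (totient n)) [d]}"
    for d k :: nat
  have "(\<lambda>k. \<Sum>d\<in>{3..9}. real (card (D d k)) / 10 ^ k)
      \<longlonglongrightarrow> (\<Sum>d\<in>{3..9}. 2 * (log 10 (real (Suc d)) - log 10 (real d)))"
    unfolding D_def by (intro tendsto_sum strong_benford_window benford) auto
  moreover have "(\<Sum>d\<in>{3..9}. 2 * (log 10 (real (Suc d)) - log 10 (real d)))
      = 2 * (log 10 10 - log 10 3)"
    by (subst sum_distrib_left[symmetric], subst sum_Suc_diff) auto
  ultimately have upper: "(\<lambda>k. \<Sum>d\<in>{3..9}. real (card (D d k)) / 10 ^ k)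
      \<longlonglongrightarrow> 2 * (log 10 10 - log 10 3)"
    by (simp only:)
  have lower: "1.0592 - 49 / 19 * sqrt (50 * 10 ^ k) / 10 ^ k
      \<le> (\<Sum>d\<in>{3..9}. real (card (D d k)) / 10 ^ k)" for k
  proof -
    have "{n\<in>{98 * 10 ^ k<..100 * 10 ^ k}. 30 * 10 ^ k \<le> totient n} \<subseteq> (\<Union>d\<in>{3..9}. D d k)"
      using large_totient_leading_digit[of _ k] by (fastforce simp: D_def)
    then have "card {n\<in>{98 * 10 ^ k<..100 * 10 ^ k}. 30 * 10 ^ k \<le> totient n}
        \<le> card (\<Union>d\<in>{3..9}. D d k)"
      by (intro card_mono) (auto simp: D_def)
    \<comment> \<open>The union bound suffices, so uniqueness of the leading digit need not be
      shown.\<close>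
    also have "\<dots> \<le> (\<Sum>d\<in>{3..9}. card (D d k))"
      by (rule card_UN_le) simp
    finally have "1.0592 * 10 ^ k - 49 / 19 * sqrt (50 * 10 ^ k) \<le> real (\<Sum>d\<in>{3..9}. card (D d k))"
      using card_large_totient_ge[of "10 ^ k"] unfolding of_nat_power of_nat_numeral by linarith
    then have "(1.0592 * 10 ^ k - 49 / 19 * sqrt (50 * 10 ^ k)) / 10 ^ k
        \<le> real (\<Sum>d\<in>{3..9}. card (D d k)) / 10 ^ k"
      by (rule divide_right_mono) simp
    then show ?thesis by (simp add: diff_divide_distrib sum_divide_distrib)
  qed
  have "(\<lambda>k::nat. 1.0592 - 49 / 19 * sqrt (50 * 10 ^ k) / 10 ^ k :: real) \<longlonglongrightarrow> 1.0592"
    by real_asymp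
  \<comment> \<open>The right-hand side is below 22/21 < 1.048.\<close>
  from LIMSEQ_le[OF this upper] lower have "1.0592 \<le> 2 * (log 10 10 - log 10 (3::real))"
    by blast
  with log_10_3_bound show False by simp
qed

end
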